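(* Assume that for every positive integer $m$ there exist at least two primes $p$ and $q$ such that $m^2 < p < q < (m+1)^2$. Then, for every positive integer $n$, between $p_n^2$ and $p_{n+1}^2$ there exist at least $4$ prime numbers, where $p_n$ is the $n$-th prime number.
   Context: Here $p_n$ denotes the $n$-th prime number, so $p_1 = 2$, $p_2 = 3$, $p_3 = 5$, and so on. The conclusion is known as Brocard's Conjecture; the assumption is a conjectural strengthening of Legendre's Conjecture (which asserts at least one prime between $m^2$ and $(m+1)^2$).
   Formalization: The conclusion is stated for every n at least 2 rather than for every positive integer n, because it fails at n = 1: between 4 and 9 the only primes are 5 and 7. *)

theory Defs
  imports "HOL-Library.Infinite_Set" "HOL-Computational_Algebra.Primes"
begin

text \<open>The primes are enumerated from 1, as is usual, whereas \<^const>\<open>enumerate\<close> counts from 0.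
  The value at 0 is a dummy.\<close>

definition nth_prime :: "nat \<Rightarrow> nat" where
  "nth_prime n = enumerate {p. prime p} (n - 1)"

definition primes_between :: "nat \<Rightarrow> nat \<Rightarrow> nat set" where
  "primes_between a b = {q. prime q \<and> a < q \<and> q < b}"

lemma nth_prime_1: "nth_prime 1 = 2"
proof -
  have "(LEAST p::nat. prime p) = 2"
    by (rule Least_equality) (auto intro: prime_ge_2_nat)
  then show ?thesis
    by (simp add: nth_prime_def enumerate_0)
qed

lemma nth_prime_2: "nth_prime 2 = 3"
proof -
  have "nth_prime 2 = (LEAST p. p \<in> {p. prime p} \<and> enumerate {p. prime p} 0 < p)"
    using enumerate_Suc''[OF primes_infinite, of 0] by (simp add: nth_prime_def)
  also have "\<dots> = (LEAST p. prime p \<and> 2 < p)"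
    using nth_prime_1 by (simp add: nth_prime_def)
  also have "\<dots> = 3"
    by (rule Least_equality) auto
  finally show ?thesis .
qed

text \<open>Brocard's bound fails for the first pair of primes: only 5 and 7 lie between 4 and 9.
  Brocard's Conjecture therefore concerns the indices from 2 on.\<close>

lemma primes_between_first_squares:
  "primes_between ((nth_prime 1)\<^sup>2) ((nth_prime 2)\<^sup>2) = {5, 7}"
proof -
  have "q = 5 \<or> q = 7" if "prime q" "4 < q" "q < 9" for q :: nat
  proof -
    have "q \<in> {5, 6, 7, 8}" using that by auto
    moreover have "\<not> prime (6::nat)" "\<not> prime (8::nat)" by simp_all
    ultimately show ?thesis using that(1) by auto
  qed
  then show ?thesis
    unfolding nth_prime_1 nth_prime_2 primes_between_def by auto
qed

end

(* Both p_n and p_(n+1) are odd for n >= 2, so p_(n+1) >= p_n + 2, and the two consecutive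
   square intervals starting at p_n^2 contribute two primes each. *)

theory Submission
  imports Defs
begin

text \<open>From the second prime on all primes are odd, so neighbours differ by at least 2
  (\<open>nth_prime_gap\<close>). With m = p_n, the range from m^2 to p_(n+1)^2 thus contains the
  disjoint open intervals from m^2 to (m+1)^2 and from (m+1)^2 to (m+2)^2, and the assumption puts
  two primes in each. From 2 to 3 the step is only 1 and a single such interval fits, which is why n
  starts at 2.\<close>

lemma prime_nth_prime: "prime (nth_prime n)"
  using enumerate_in_set[OF primes_infinite, of "n - 1"] by (simp add: nth_prime_def)

text \<open>Truncated subtraction makes indices 0 and 1 both name the prime 2;
  \<open>1 \<le> m\<close> excludes this collision.\<close>

lemma nth_prime_less:
  assumes "1 \<le> m" "m < n"
  shows "nth_prime m < nth_prime n"
  unfolding nth_prime_def using assms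
  by (intro enumerate_mono primes_infinite) auto

lemma odd_nth_prime:
  assumes "n \<ge> 2"
  shows "odd (nth_prime n)"
proof (rule prime_odd_nat[OF prime_nth_prime])
  show "2 < nth_prime n"
    using nth_prime_less[of 1 n] assms unfolding nth_prime_1 by simp
qed

text \<open>Parity: a gap of exactly 1 would make one of two odd numbers even.\<close>

lemma nth_prime_gap:
  assumes "n \<ge> 2"
  shows "nth_prime n + 2 \<le> nth_prime (n + 1)"
proof -
  have "nth_prime n < nth_prime (n + 1)"
    using assms by (intro nth_prime_less) auto
  moreover have "nth_prime (n + 1) \<noteq> nth_prime n + 1"
    using odd_nth_prime[of n] odd_nth_prime[of "n + 1"] assms by auto
  ultimately show ?thesis by linarith
qed

text \<open>Required for \<open>card_mono\<close>, since \<open>card\<close> is 0 on infinite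
  sets.\<close>

lemma finite_primes_between: "finite (primes_between a b)"
  by (rule finite_subset[of _ "{..<b}"]) (auto simp: primes_between_def)

theorem proposition3:
  assumes "\<forall>m::nat. m \<ge> 1 \<longrightarrow>
    (\<exists>p q::nat. prime p \<and> prime q \<and> m\<^sup>2 < p \<and> p < q \<and> q < (m + 1)\<^sup>2)"
  shows "\<forall>n::nat. n \<ge> 2 \<longrightarrow>
    card (primes_between ((nth_prime n)\<^sup>2) ((nth_prime (n + 1))\<^sup>2)) \<ge> 4"
proof (intro allI impI)
  fix n :: nat
  assume n: "n \<ge> 2"
  define m where "m = nth_prime n"
  have "m \<ge> 1"
    using prime_ge_1_nat[OF prime_nth_prime] by (simp add: m_def)
  \<comment> \<open>The assumption is used at m and at m + 1; the common endpoint (m+1)^2 separates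
    q from r, so the four primes are distinct.\<close>
  then obtain p q r s where
    pq: "prime p" "prime q" "m\<^sup>2 < p" "p < q" "q < (m + 1)\<^sup>2" and
    rs: "prime r" "prime s" "(m + 1)\<^sup>2 < r" "r < s" "s < (m + 2)\<^sup>2"
    using assms[rule_format, of m] assms[rule_format, of "m + 1"] by auto
  have "(m + 2)\<^sup>2 \<le> (nth_prime (n + 1))\<^sup>2"
    using nth_prime_gap[OF n] by (intro power_mono) (auto simp: m_def)
  then have "s < (nth_prime (n + 1))\<^sup>2"
    using rs by linarith
  moreover have "q < r"
    using pq rs by linarith
  ultimately have "{p, q, r, s} \<subseteq> primes_between (m\<^sup>2) ((nth_prime (n + 1))\<^sup>2)"
    using pq(1-4) rs(1,2,4) by (auto simp: primes_between_def)
  then have "card {p, q, r, s} \<le> card (primes_between (m\<^sup>2) ((nth_prime (n + 1))\<^sup>2))"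
    by (intro card_mono finite_primes_between)
  moreover have "card {p, q, r, s} = 4"
    using \<open>p < q\<close> \<open>q < r\<close> \<open>r < s\<close> by auto
  ultimately show "4 \<le> card (primes_between ((nth_prime n)\<^sup>2) ((nth_prime (n + 1))\<^sup>2))"
    by (simp add: m_def)
qed

end
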